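(* For any infinite cardinals $\kappa\le\lambda$, if $\kappa$ has the $\lambda$-filter extension property, then $\kappa$ is $\lambda$-square compact.
   Context: All topological spaces are Hausdorff. A space is $(<\kappa)$-compact if every open cover has a subcover of cardinality $<\kappa$; $w(X)$ is the weight. $\kappa$ is $\lambda$-square compact if for every $(<\kappa)$-compact space $X$ with $w(X)\le\lambda$, $X\times X$ (product topology) is $(<\kappa)$-compact. $2^\lambda$ denotes the set of functions $\lambda\to 2$. A filter on a set $X$ is $(<\kappa)$-complete if the intersection of any subfamily of size $<\kappa$ lies in it. A family $\mathscr{F}\subseteq\mathscr{P}(X)$ measures $A\subseteq X$ if $A\in\mathscr{F}$ or $X\setminus A\in\mathscr{F}$, and measures a family if it measures each member. $\kappa$ has the $\lambda$-filter extension property if for every family $\mathscr{A}\subseteq\mathscr{P}(2^\lambda)$ with $|\mathscr{A}|\le\lambda$, every $(<\kappa)$-complete (proper) filter over $2^\lambda$ generated by at most $\lambda$ elements can be extended to a $(<\kappa)$-complete (proper) filter over $2^\lambda$ measuring $\mathscr{A}$.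
   Formalization: For singular κ the filter extension property is strengthened: the family generated by ≤λ sets via <κ-intersections need only be a proper filter, not (<κ)-complete; as stated the claim fails for every singular κ=λ. For regular κ nothing changes. *)

theory Defs
  imports "HOL-Analysis.Analysis"
begin

unbundle cardinal_syntax

text \<open>
  Cardinals are the cardinal orders of the library: an infinite cardinal is a relation
  satisfying \<^const>\<open>Cinfinite\<close>, the underlying set of the cardinal is its \<^const>\<open>Field\<close>,
  and sizes are compared by \<open>\<le>o\<close> and \<open><o\<close>, also across different types. Since the lower-case symbol is reserved for abstraction,
  the larger cardinal \<^emph>\<open>lambda\<close> is written \<open>\<Lambda>\<close>.
\<close>

section \<open>Square compactness\<close>

definition less_compact_space :: "'k rel \<Rightarrow> 'a topology \<Rightarrow> bool" where
  "less_compact_space \<kappa> X \<longleftrightarrow>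
     (\<forall>\<U>. (\<forall>U\<in>\<U>. openin X U) \<and> \<Union>\<U> = topspace X \<longrightarrow>
          (\<exists>\<V>\<subseteq>\<U>. |\<V>| <o \<kappa> \<and> \<Union>\<V> = topspace X))"

definition topology_base :: "'a topology \<Rightarrow> 'a set set \<Rightarrow> bool" where
  "topology_base X \<B> \<longleftrightarrow> openin X = arbitrary union_of (\<lambda>U. U \<in> \<B>)"

definition weight :: "'a topology \<Rightarrow> 'a set rel" where
  "weight X =
     |SOME \<B>. topology_base X \<B> \<and> (\<forall>\<C>. topology_base X \<C> \<longrightarrow> |\<B>| \<le>o |\<C>| )|"

text \<open>
  The type argument only fixes the type of the points of the spaces. A Hausdorff space of
  weight at most \<open>\<Lambda>\<close> has at most \<open>2 ^ \<Lambda>\<close> points, so a statement with this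
  argument free covers all spaces.
\<close>

definition square_compact :: "'a itself \<Rightarrow> 'k rel \<Rightarrow> 'l rel \<Rightarrow> bool" where
  "square_compact _ \<kappa> \<Lambda> \<longleftrightarrow>
     (\<forall>X :: 'a topology.
        Hausdorff_space X \<and> less_compact_space \<kappa> X \<and> weight X \<le>o \<Lambda> \<longrightarrow>
        less_compact_space \<kappa> (prod_topology X X))"


section \<open>Complete filters and the filter extension property\<close>

definition proper_filter_on :: "'a set \<Rightarrow> 'a set set \<Rightarrow> bool" where
  "proper_filter_on S F \<longleftrightarrow>
     F \<subseteq> Pow S \<and> S \<in> F \<and> {} \<notin> F \<and>
     (\<forall>A\<in>F. \<forall>B\<in>F. A \<inter> B \<in> F) \<and>
     (\<forall>A\<in>F. \<forall>B. A \<subseteq> B \<and> B \<subseteq> S \<longrightarrow> B \<in> F)"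

text \<open>The intersection with \<open>S\<close> matters only for the empty subfamily.\<close>

definition less_complete :: "'k rel \<Rightarrow> 'a set \<Rightarrow> 'a set set \<Rightarrow> bool" where
  "less_complete \<kappa> S F \<longleftrightarrow> (\<forall>H\<subseteq>F. |H| <o \<kappa> \<longrightarrow> S \<inter> \<Inter>H \<in> F)"

definition measures_set :: "'a set \<Rightarrow> 'a set set \<Rightarrow> 'a set \<Rightarrow> bool" where
  "measures_set S F A \<longleftrightarrow> A \<in> F \<or> S - A \<in> F"

definition measures_family :: "'a set \<Rightarrow> 'a set set \<Rightarrow> 'a set set \<Rightarrow> bool" where
  "measures_family S F \<A> \<longleftrightarrow> (\<forall>A\<in>\<A>. measures_set S F A)"

text \<open>
  The \<open>(<\<kappa>)\<close>-complete filter over \<open>S\<close> generated by \<open>G\<close>: the sets that contain an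
  intersection of fewer than \<open>\<kappa>\<close> members of \<open>G\<close>. For regular \<open>\<kappa>\<close>, if it is proper, it
  is the least proper \<open>(<\<kappa>)\<close>-complete filter containing \<open>G\<close>
  (lemma \<open>complete_filter_generated_iff_least\<close>), so the filter extension property below
  is the one that quantifies over \<open>(<\<kappa>)\<close>-complete filters
  (lemma \<open>filter_extension_property_iff_regular\<close>). For singular \<open>\<kappa>\<close> the generated filter
  need not itself be \<open>(<\<kappa>)\<close>-complete, and this is not required below: with that requirement
  every singular \<open>\<kappa>\<close> would have the \<open>\<kappa>\<close>-filter extension property (all filters concerned
  are principal) without being \<open>\<kappa>\<close>-square compact.
\<close>

definition complete_filter_generated :: "'k rel \<Rightarrow> 'a set \<Rightarrow> 'a set set \<Rightarrow> 'a set set" where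
  "complete_filter_generated \<kappa> S G =
     {A. A \<subseteq> S \<and> (\<exists>H\<subseteq>G. |H| <o \<kappa> \<and> S \<inter> \<Inter>H \<subseteq> A)}"

definition two_power :: "'l rel \<Rightarrow> ('l \<Rightarrow> bool) set" where
  "two_power \<Lambda> = (Field \<Lambda> \<rightarrow>\<^sub>E (UNIV :: bool set))"

definition filter_extension_property :: "'k rel \<Rightarrow> 'l rel \<Rightarrow> bool" where
  "filter_extension_property \<kappa> \<Lambda> \<longleftrightarrow>
     (\<forall>\<A> F G. \<A> \<subseteq> Pow (two_power \<Lambda>) \<and> |\<A>| \<le>o \<Lambda> \<and>
        G \<subseteq> Pow (two_power \<Lambda>) \<and> |G| \<le>o \<Lambda> \<and>
        F = complete_filter_generated \<kappa> (two_power \<Lambda>) G \<and>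
        proper_filter_on (two_power \<Lambda>) F \<longrightarrow>
        (\<exists>F'. F \<subseteq> F' \<and> proper_filter_on (two_power \<Lambda>) F' \<and>
              less_complete \<kappa> (two_power \<Lambda>) F' \<and>
              measures_family (two_power \<Lambda>) F' \<A>))"


section \<open>Sanity checks\<close>

lemma weight_ordLeq_iff:
  "weight X \<le>o r \<longleftrightarrow> (\<exists>\<B>. topology_base X \<B> \<and> |\<B>| \<le>o r)"
proof -
  let ?P = "\<lambda>\<B>. topology_base X \<B> \<and> (\<forall>\<C>. topology_base X \<C> \<longrightarrow> |\<B>| \<le>o |\<C>| )"
  let ?R = "(\<lambda>\<B>. |\<B>| ) ` {\<B>. topology_base X \<B>}"
  have "topology_base X {U. openin X U}"
    unfolding topology_base_def openin_topology_base_unique by auto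
  then have "?R \<noteq> {}" by blast
  moreover have "\<forall>r\<in>?R. Card_order r" by (auto simp: card_of_Card_order)
  ultimately have "\<exists>r\<in>?R. \<forall>r'\<in>?R. r \<le>o r'" by (rule exists_minim_Card_order)
  then have "\<exists>\<B>. ?P \<B>" by auto
  then have *: "?P (SOME \<B>. ?P \<B>)" by (rule someI_ex)
  show ?thesis
  proof
    assume "weight X \<le>o r"
    then show "\<exists>\<B>. topology_base X \<B> \<and> |\<B>| \<le>o r"
      unfolding weight_def using * by blast
  next
    assume "\<exists>\<B>. topology_base X \<B> \<and> |\<B>| \<le>o r"
    then obtain \<B> where \<B>: "topology_base X \<B>" "|\<B>| \<le>o r" by blast
    have "weight X \<le>o |\<B>|" unfolding weight_def using * \<B>(1) by blast
    then show "weight X \<le>o r" using \<B>(2) by (rule ordLeq_transitive)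
  qed
qed

lemma complete_filter_generated_subset:
  assumes "proper_filter_on S F" "less_complete \<kappa> S F" "G \<subseteq> F"
  shows "complete_filter_generated \<kappa> S G \<subseteq> F"
proof
  fix A assume "A \<in> complete_filter_generated \<kappa> S G"
  then obtain H where H: "A \<subseteq> S" "H \<subseteq> G" "|H| <o \<kappa>" "S \<inter> \<Inter>H \<subseteq> A"
    unfolding complete_filter_generated_def by blast
  then have "S \<inter> \<Inter>H \<in> F"
    using assms(2,3) unfolding less_complete_def by (meson subset_trans)
  then show "A \<in> F"
    using H assms(1) unfolding proper_filter_on_def by blast
qed

lemma subset_complete_filter_generated:
  assumes "Cinfinite \<kappa>" "G \<subseteq> Pow S"
  shows "G \<subseteq> complete_filter_generated \<kappa> S G"
proof
  fix A assume A: "A \<in> G"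
  have "|{A}| <o \<kappa>"
    using assms(1) by (intro Cfinite_ordLess_Cinfinite) (auto simp: cfinite_def Field_card_of card_of_card_order_on)
  moreover have "{A} \<subseteq> G" "A \<subseteq> S" "S \<inter> \<Inter>{A} \<subseteq> A" using A assms(2) by auto
  ultimately show "A \<in> complete_filter_generated \<kappa> S G"
    unfolding complete_filter_generated_def by blast
qed

lemma less_complete_complete_filter_generated:
  assumes "Cinfinite \<kappa>" "regularCard \<kappa>"
  shows "less_complete \<kappa> S (complete_filter_generated \<kappa> S G)"
  unfolding less_complete_def
proof (intro allI impI)
  fix H assume H: "H \<subseteq> complete_filter_generated \<kappa> S G" "|H| <o \<kappa>"
  then have "\<forall>A\<in>H. \<exists>K. K \<subseteq> G \<and> |K| <o \<kappa> \<and> S \<inter> \<Inter>K \<subseteq> A"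
    unfolding complete_filter_generated_def by blast
  then obtain k where k: "\<And>A. A \<in> H \<Longrightarrow> k A \<subseteq> G \<and> |k A| <o \<kappa> \<and> S \<inter> \<Inter>(k A) \<subseteq> A"
    by metis
  have "|\<Union>A\<in>H. k A| <o \<kappa>"
    by (rule regularCard_UNION_bound[OF assms H(2)]) (use k in blast)
  moreover have "(\<Union>A\<in>H. k A) \<subseteq> G" using k by blast
  moreover have "S \<inter> \<Inter>(\<Union>A\<in>H. k A) \<subseteq> S \<inter> \<Inter>H"
  proof
    fix x assume x: "x \<in> S \<inter> \<Inter>(\<Union>A\<in>H. k A)"
    have "x \<in> A" if "A \<in> H" for A
    proof -
      have "x \<in> S \<inter> \<Inter>(k A)" using x that by blast
      then show ?thesis using k[OF that] by blast
    qed
    then show "x \<in> S \<inter> \<Inter>H" using x by blast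
  qed
  ultimately have "\<exists>K\<subseteq>G. |K| <o \<kappa> \<and> S \<inter> \<Inter>K \<subseteq> S \<inter> \<Inter>H"
    by (intro exI[of _ "\<Union>A\<in>H. k A"] conjI)
  then show "S \<inter> \<Inter>H \<in> complete_filter_generated \<kappa> S G"
    unfolding complete_filter_generated_def by blast
qed

lemma complete_filter_generated_iff_least:
  fixes S :: "'a set"
  assumes "Cinfinite \<kappa>" "regularCard \<kappa>" "G \<subseteq> Pow S"
  shows "(F = complete_filter_generated \<kappa> S G \<and> proper_filter_on S F) \<longleftrightarrow>
         (proper_filter_on S F \<and> less_complete \<kappa> S F \<and> G \<subseteq> F \<and>
          (\<forall>F'. proper_filter_on S F' \<and> less_complete \<kappa> S F' \<and> G \<subseteq> F' \<longrightarrow> F \<subseteq> F'))"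
    (is "?L \<longleftrightarrow> ?R")
proof
  assume ?L
  then have F: "F = complete_filter_generated \<kappa> S G" and "proper_filter_on S F"
    by blast+
  moreover have "less_complete \<kappa> S F"
    unfolding F by (rule less_complete_complete_filter_generated[OF assms(1,2)])
  moreover have "G \<subseteq> F"
    unfolding F by (rule subset_complete_filter_generated[OF assms(1,3)])
  moreover have "F \<subseteq> F'"
    if "proper_filter_on S F'" "less_complete \<kappa> S F'" "G \<subseteq> F'" for F'
    unfolding F using that by (rule complete_filter_generated_subset)
  ultimately show ?R by blast
next
  assume R: ?R
  let ?C = "complete_filter_generated \<kappa> S G"
  have sub: "?C \<subseteq> F" using R complete_filter_generated_subset by blast
  have compl: "less_complete \<kappa> S ?C"
    by (rule less_complete_complete_filter_generated[OF assms(1,2)])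
  have fin: "|H| <o \<kappa>" if "finite H" for H :: "'a set set"
    using assms(1) that
    by (intro Cfinite_ordLess_Cinfinite) (auto simp: cfinite_def Field_card_of card_of_card_order_on)
  have C_sub: "A \<subseteq> S" if "A \<in> ?C" for A
    using that unfolding complete_filter_generated_def by blast
  have inter: "A \<inter> B \<in> ?C" if "A \<in> ?C" "B \<in> ?C" for A B
  proof -
    have "S \<inter> \<Inter>{A, B} \<in> ?C"
      using compl[unfolded less_complete_def, rule_format, of "{A, B}"] that fin[of "{A, B}"]
      by blast
    moreover have "S \<inter> \<Inter>{A, B} = A \<inter> B" using C_sub[OF that(1)] by auto
    ultimately show ?thesis by simp
  qed
  have "S \<inter> \<Inter>{} \<in> ?C"
    using compl[unfolded less_complete_def, rule_format, of "{}"] fin[of "{}"] by blast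
  then have S_in: "S \<in> ?C" by simp
  have "{} \<notin> F" using R unfolding proper_filter_on_def by simp
  then have nonempty: "{} \<notin> ?C" using sub by (rule contra_subsetD[rotated])
  have up: "B \<in> ?C" if "A \<in> ?C" "A \<subseteq> B" "B \<subseteq> S" for A B
  proof -
    obtain H where H: "H \<subseteq> G" "|H| <o \<kappa>" "S \<inter> \<Inter>H \<subseteq> A"
      using \<open>A \<in> ?C\<close> unfolding complete_filter_generated_def by blast
    moreover have "S \<inter> \<Inter>H \<subseteq> B" using H(3) that(2) by (rule subset_trans)
    ultimately show ?thesis using that(3) unfolding complete_filter_generated_def by blast
  qed
  have "?C \<subseteq> Pow S" unfolding complete_filter_generated_def by blast
  then have "proper_filter_on S ?C"
    unfolding proper_filter_on_def using S_in nonempty inter up by simp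
  then have "F \<subseteq> ?C"
    using R compl subset_complete_filter_generated[OF assms(1,3)] by blast
  then show ?L using R sub by blast
qed

lemma filter_extension_property_iff_regular:
  fixes \<kappa> :: "'k rel" and \<Lambda> :: "'l rel"
  assumes "Cinfinite \<kappa>" "regularCard \<kappa>"
  defines "S \<equiv> two_power \<Lambda>"
  shows "filter_extension_property \<kappa> \<Lambda> \<longleftrightarrow>
     (\<forall>\<A> F G. \<A> \<subseteq> Pow S \<and> |\<A>| \<le>o \<Lambda> \<and> G \<subseteq> Pow S \<and> |G| \<le>o \<Lambda> \<and>
        proper_filter_on S F \<and> less_complete \<kappa> S F \<and> G \<subseteq> F \<and>
        (\<forall>F'. proper_filter_on S F' \<and> less_complete \<kappa> S F' \<and> G \<subseteq> F' \<longrightarrow> F \<subseteq> F') \<longrightarrow>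
        (\<exists>F'. F \<subseteq> F' \<and> proper_filter_on S F' \<and> less_complete \<kappa> S F' \<and>
              measures_family S F' \<A>))"
  unfolding filter_extension_property_def S_def[symmetric]
proof (intro all_cong1)
  fix \<A> F G
  let ?E = "\<exists>F'. F \<subseteq> F' \<and> proper_filter_on S F' \<and> less_complete \<kappa> S F' \<and> measures_family S F' \<A>"
  show "(\<A> \<subseteq> Pow S \<and> |\<A>| \<le>o \<Lambda> \<and> G \<subseteq> Pow S \<and> |G| \<le>o \<Lambda> \<and>
         F = complete_filter_generated \<kappa> S G \<and> proper_filter_on S F \<longrightarrow> ?E) \<longleftrightarrow>
        (\<A> \<subseteq> Pow S \<and> |\<A>| \<le>o \<Lambda> \<and> G \<subseteq> Pow S \<and> |G| \<le>o \<Lambda> \<and>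
         proper_filter_on S F \<and> less_complete \<kappa> S F \<and> G \<subseteq> F \<and>
         (\<forall>F'. proper_filter_on S F' \<and> less_complete \<kappa> S F' \<and> G \<subseteq> F' \<longrightarrow> F \<subseteq> F') \<longrightarrow> ?E)"
  proof (cases "G \<subseteq> Pow S")
    case True
    show ?thesis
      unfolding complete_filter_generated_iff_least[OF assms(1,2) True] ..
  next
    case False
    then show ?thesis by (simp only: simp_thms)
  qed
qed

end

theory Submission
  imports Defs
begin

text \<open>
  A cover of \<open>X \<times> X\<close> by at most \<open>\<Lambda>\<close> basic open rectangles without small subcover makes the
  complements of its members generate a proper filter. Since \<open>X \<times> X\<close> is an image of
  \<open>2 ^ \<Lambda>\<close>, this filter can be pulled back there and extended to a complete filter measuring
  the preimages of a base of \<open>X\<close> under both coordinates. By compactness of \<open>X\<close> both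
  coordinates converge along this filter, say to \<open>x\<close> and \<open>y\<close>, and the rectangle of the cover
  that contains \<open>(x, y)\<close> then lies in the filter together with its complement.
\<close>

lemma topology_base_openin: "topology_base X \<B> \<Longrightarrow> B \<in> \<B> \<Longrightarrow> openin X B"
  unfolding topology_base_def openin_topology_base_unique by blast

lemma topology_base_subset_topspace: "topology_base X \<B> \<Longrightarrow> B \<in> \<B> \<Longrightarrow> B \<subseteq> topspace X"
  by (simp add: openin_subset topology_base_openin)

lemma topology_base_point:
  assumes "topology_base X \<B>" "openin X U" "x \<in> U"
  obtains B where "B \<in> \<B>" "x \<in> B" "B \<subseteq> U"
  using assms unfolding topology_base_def openin_topology_base_unique by blast

lemma topology_base_prod:
  assumes "topology_base X \<B>" "topology_base Y \<C>"
  shows "topology_base (prod_topology X Y) ((\<lambda>(B, C). B \<times> C) ` (\<B> \<times> \<C>))"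
  unfolding topology_base_def openin_topology_base_unique
proof (intro conjI allI impI)
  fix V assume "V \<in> (\<lambda>(B, C). B \<times> C) ` (\<B> \<times> \<C>)"
  then show "openin (prod_topology X Y) V"
    using assms by (auto simp: openin_prod_Times_iff topology_base_openin)
next
  fix U p assume "openin (prod_topology X Y) U \<and> p \<in> U"
  then obtain V W where VW: "openin X V" "openin Y W" "fst p \<in> V" "snd p \<in> W" "V \<times> W \<subseteq> U"
    unfolding openin_prod_topology_alt by (metis prod.collapse)
  obtain B where "B \<in> \<B>" "fst p \<in> B" "B \<subseteq> V"
    using topology_base_point[OF assms(1) VW(1,3)] .
  moreover obtain C where "C \<in> \<C>" "snd p \<in> C" "C \<subseteq> W"
    using topology_base_point[OF assms(2) VW(2,4)] .
  ultimately have "B \<times> C \<in> (\<lambda>(B, C). B \<times> C) ` (\<B> \<times> \<C>)" "p \<in> B \<times> C" "B \<times> C \<subseteq> U"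
    using VW(5) by (auto simp: mem_Times_iff)
  then show "\<exists>V. V \<in> (\<lambda>(B, C). B \<times> C) ` (\<B> \<times> \<C>) \<and> p \<in> V \<and> V \<subseteq> U"
    by blast
qed

text \<open>Each point is coded by the set of basic open sets that contain it. Separation makes the
  code injective, and an inverse of the code is the required map. With
  \<open>prod_topology X X\<close> in place of \<open>X\<close>, this lets filters over
  \<open>two_power \<Lambda>\<close> speak about pairs of points.\<close>

lemma two_power_surj_Hausdorff:
  assumes "Hausdorff_space X" "topology_base X \<B>" "|\<B>| \<le>o \<Lambda>" "Card_order \<Lambda>"
  obtains g where "topspace X \<subseteq> g ` two_power \<Lambda>"
proof -
  have "|\<B>| \<le>o |Field \<Lambda>|"
    by (rule ordLeq_ordIso_trans[OF assms(3) ordIso_symmetric[OF card_of_Field_ordIso[OF assms(4)]]])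
  then obtain f where f: "inj_on f \<B>" "f ` \<B> \<subseteq> Field \<Lambda>"
    unfolding card_of_ordLeq[symmetric] by (elim exE conjE)
  \<comment> \<open>The characteristic function of the indices of the basic sets around
    \<open>x\<close>; \<open>restrict\<close> makes it extensional, as membership in
    \<open>two_power \<Lambda>\<close> demands.\<close>
  define e where "e x = restrict (\<lambda>i. \<exists>B\<in>\<B>. x \<in> B \<and> f B = i) (Field \<Lambda>)" for x
  have e_iff: "e x (f B) \<longleftrightarrow> x \<in> B" if "B \<in> \<B>" for x B
    using that f by (auto simp: e_def inj_on_eq_iff)
  have "inj_on e (topspace X)"
  proof (rule inj_onI, rule ccontr)
    fix x y assume xy: "x \<in> topspace X" "y \<in> topspace X" "e x = e y" "x \<noteq> y"
    then obtain U where U: "openin X U" "x \<in> U" "y \<notin> U"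
      using assms(1) unfolding Hausdorff_space_def disjnt_def by blast
    obtain B where "B \<in> \<B>" "x \<in> B" "B \<subseteq> U"
      using topology_base_point[OF assms(2) U(1,2)] .
    then show False using e_iff[of B x] e_iff[of B y] xy(3) U(3) by auto
  qed
  moreover have "e ` topspace X \<subseteq> two_power \<Lambda>"
    by (auto simp: e_def two_power_def)
  \<comment> \<open>Only an inclusion is claimed: \<open>inv_into\<close> is arbitrary outside the
    range of \<open>e\<close>, so some values may lie outside the space.\<close>
  ultimately have "topspace X \<subseteq> inv_into (topspace X) e ` two_power \<Lambda>"
    by (metis image_mono inv_into_image_cancel order_refl)
  then show thesis by (rule that)
qed

text \<open>A cover is refined to the basic sets below its members, and a small basic subcover is
  then enlarged back by choosing a member above each set. In the theorem this bounds the size of the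
  cover by that of the base, so that the filter made from it has at most \<Lambda>
  generators.\<close>

lemma less_compact_space_baseI:
  assumes "topology_base X \<B>"
    and "\<And>\<U>. \<U> \<subseteq> \<B> \<Longrightarrow> \<Union>\<U> = topspace X \<Longrightarrow> \<exists>\<V>\<subseteq>\<U>. |\<V>| <o \<kappa> \<and> \<Union>\<V> = topspace X"
  shows "less_compact_space \<kappa> X"
  unfolding less_compact_space_def
proof (intro allI impI)
  fix \<U> assume \<U>: "(\<forall>U\<in>\<U>. openin X U) \<and> \<Union>\<U> = topspace X"
  let ?\<R> = "{B \<in> \<B>. \<exists>U\<in>\<U>. B \<subseteq> U}"
  have "\<Union>?\<R> = topspace X"
  proof
    show "\<Union>?\<R> \<subseteq> topspace X" using \<U> by blast
    show "topspace X \<subseteq> \<Union>?\<R>"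
    proof
      fix x assume "x \<in> topspace X"
      then obtain U where U: "U \<in> \<U>" "x \<in> U" using \<U> by blast
      then have "openin X U" using \<U> by blast
      then obtain B where "B \<in> \<B>" "x \<in> B" "B \<subseteq> U"
        using topology_base_point[OF assms(1) _ U(2)] by blast
      then show "x \<in> \<Union>?\<R>" using U by blast
    qed
  qed
  from assms(2)[OF Collect_restrict this]
  obtain \<V> where \<V>: "\<V> \<subseteq> ?\<R>" "|\<V>| <o \<kappa>" "\<Union>\<V> = topspace X"
    by (elim exE conjE)
  from \<V>(1) have "\<forall>B\<in>\<V>. \<exists>U. U \<in> \<U> \<and> B \<subseteq> U" by blast
  from bchoice[OF this] obtain u where u: "\<And>B. B \<in> \<V> \<Longrightarrow> u B \<in> \<U> \<and> B \<subseteq> u B"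
    by blast
  have "|u ` \<V>| <o \<kappa>"
    using card_of_image \<V>(2) by (rule ordLeq_ordLess_trans)
  moreover have "u ` \<V> \<subseteq> \<U>" using u by blast
  moreover have "\<Union>(u ` \<V>) = topspace X"
  proof
    show "\<Union>(u ` \<V>) \<subseteq> topspace X" using u \<U> by blast
    show "topspace X \<subseteq> \<Union>(u ` \<V>)" unfolding \<V>(3)[symmetric] using u by blast
  qed
  ultimately show "\<exists>\<V>\<subseteq>\<U>. |\<V>| <o \<kappa> \<and> \<Union>\<V> = topspace X" by blast
qed

text \<open>If every point failed, the basic sets with preimage outside \<open>F\<close> would cover
  the space, and so would fewer than \<kappa> of them. As \<open>F\<close> measures these preimages,
  it contains their complements, hence by completeness the intersection of these. That is disjoint
  from the set in \<open>top\<close>, which keeps out points where \<open>f\<close> leaves the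
  space.\<close>

lemma less_compact_space_limit_point:
  assumes "less_compact_space \<kappa> X" "topology_base X \<B>"
    and F: "proper_filter_on S F" "less_complete \<kappa> S F"
    and top: "{s \<in> S. f s \<in> topspace X} \<in> F"
    and meas: "\<And>B. B \<in> \<B> \<Longrightarrow> measures_set S F {s \<in> S. f s \<in> B}"
  obtains x where "x \<in> topspace X" "\<And>B. B \<in> \<B> \<Longrightarrow> x \<in> B \<Longrightarrow> {s \<in> S. f s \<in> B} \<in> F"
proof -
  let ?\<U> = "{B \<in> \<B>. {s \<in> S. f s \<in> B} \<notin> F}"
  have "\<Union>?\<U> \<noteq> topspace X"
  proof
    assume "\<Union>?\<U> = topspace X"
    moreover have "\<forall>B\<in>?\<U>. openin X B" using assms(2) topology_base_openin by blast
    ultimately obtain \<V> where \<V>: "\<V> \<subseteq> ?\<U>" "|\<V>| <o \<kappa>" "\<Union>\<V> = topspace X"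
      using assms(1) unfolding less_compact_space_def by meson
    let ?H = "(\<lambda>B. S - {s \<in> S. f s \<in> B}) ` \<V>"
    have "?H \<subseteq> F" using \<V>(1) meas unfolding measures_set_def by blast
    moreover have "|?H| <o \<kappa>"
      using card_of_image \<V>(2) by (rule ordLeq_ordLess_trans)
    ultimately have "S \<inter> \<Inter>?H \<in> F" using F(2) unfolding less_complete_def by blast
    then have "(S \<inter> \<Inter>?H) \<inter> {s \<in> S. f s \<in> topspace X} \<in> F"
      using top F(1) unfolding proper_filter_on_def by blast
    moreover have "(S \<inter> \<Inter>?H) \<inter> {s \<in> S. f s \<in> topspace X} = {}"
      using \<V>(3) by auto
    ultimately show False using F(1) unfolding proper_filter_on_def by simp
  qed
  moreover have "\<Union>?\<U> \<subseteq> topspace X"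
    using assms(2) topology_base_subset_topspace by blast
  ultimately obtain x where "x \<in> topspace X" "x \<notin> \<Union>?\<U>" by blast
  then show thesis using that by blast
qed

lemma card_of_empty_ordLess_Cinfinite: "Cinfinite \<kappa> \<Longrightarrow> |{}| <o \<kappa>"
  by (intro Cfinite_ordLess_Cinfinite)
    (auto simp: cfinite_def Field_card_of card_of_card_order_on)

text \<open>Binary intersections only require the union of two families of size below \<kappa> to be
  again of size below \<kappa>. This holds for every infinite \<kappa>, singular ones
  included.\<close>

lemma proper_complete_filter_generated:
  assumes "Cinfinite \<kappa>" "\<And>H. H \<subseteq> G \<Longrightarrow> |H| <o \<kappa> \<Longrightarrow> S \<inter> \<Inter>H \<noteq> {}"
  shows "proper_filter_on S (complete_filter_generated \<kappa> S G)"
proof -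
  let ?C = "complete_filter_generated \<kappa> S G"
  have "S \<in> ?C"
    using card_of_empty_ordLess_Cinfinite[OF assms(1)]
    unfolding complete_filter_generated_def by blast
  moreover have "{} \<notin> ?C"
    using assms(2) unfolding complete_filter_generated_def by blast
  moreover have "A \<inter> B \<in> ?C" if AB: "A \<in> ?C" "B \<in> ?C" for A B
  proof -
    obtain H K where HK: "H \<subseteq> G" "|H| <o \<kappa>" "S \<inter> \<Inter>H \<subseteq> A" "K \<subseteq> G" "|K| <o \<kappa>" "S \<inter> \<Inter>K \<subseteq> B"
      using AB unfolding complete_filter_generated_def by blast
    have "|H \<union> K| <o \<kappa>"
      using assms(1) HK(2,5) by (intro card_of_Un_ordLess_infinite_Field)
        (auto simp: cinfinite_def)
    moreover have "H \<union> K \<subseteq> G" "S \<inter> \<Inter>(H \<union> K) \<subseteq> A \<inter> B" "A \<inter> B \<subseteq> S"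
      using HK AB unfolding complete_filter_generated_def by blast+
    ultimately show ?thesis unfolding complete_filter_generated_def by blast
  qed
  moreover have "B \<in> ?C" if "A \<in> ?C" "A \<subseteq> B" "B \<subseteq> S" for A B
    using that unfolding complete_filter_generated_def by (blast intro: subset_trans)
  moreover have "?C \<subseteq> Pow S" unfolding complete_filter_generated_def by blast
  ultimately show ?thesis unfolding proper_filter_on_def by blast
qed

theorem theorem3p6:
  fixes \<kappa> :: "'k rel" and \<Lambda> :: "'l rel"
  assumes "Cinfinite \<kappa>" and "Cinfinite \<Lambda>" and "\<kappa> \<le>o \<Lambda>"
    and "filter_extension_property \<kappa> \<Lambda>"
  shows "square_compact TYPE('a) \<kappa> \<Lambda>"
  unfolding square_compact_def
proof (intro allI impI, elim conjE)
  fix X :: "'a topology"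
  assume X: "Hausdorff_space X" "less_compact_space \<kappa> X" "weight X \<le>o \<Lambda>"
  let ?S = "two_power \<Lambda>" and ?Y = "topspace X \<times> topspace X"
  have \<Lambda>: "\<not> finite (Field \<Lambda>)" "Card_order \<Lambda>" using assms(2) by (auto simp: cinfinite_def)
  obtain \<B> where \<B>: "topology_base X \<B>" "|\<B>| \<le>o \<Lambda>"
    using X(3) unfolding weight_ordLeq_iff by blast
  let ?\<D> = "(\<lambda>(B, C). B \<times> C) ` (\<B> \<times> \<B>)"
  have \<D>: "topology_base (prod_topology X X) ?\<D>" using \<B>(1) \<B>(1) by (rule topology_base_prod)
  have \<D>_le: "|?\<D>| \<le>o \<Lambda>"
    using card_of_image card_of_Times_ordLeq_infinite_Field[OF \<Lambda>(1) \<B>(2) \<B>(2) \<Lambda>(2)]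
    by (rule ordLeq_transitive)
  have "Hausdorff_space (prod_topology X X)"
    using X(1) by (simp add: Hausdorff_space_prod_topology)
  from two_power_surj_Hausdorff[OF this \<D> \<D>_le \<Lambda>(2)]
  obtain g where g: "?Y \<subseteq> g ` ?S" by auto
  show "less_compact_space \<kappa> (prod_topology X X)"
  proof (rule less_compact_space_baseI[OF \<D>], rule ccontr)
    fix \<U> assume \<U>: "\<U> \<subseteq> ?\<D>" "\<Union>\<U> = topspace (prod_topology X X)"
      and "\<not> (\<exists>\<V>\<subseteq>\<U>. |\<V>| <o \<kappa> \<and> \<Union>\<V> = topspace (prod_topology X X))"
    then have no_subcover: "\<Union>\<V> \<noteq> ?Y" if "\<V> \<subseteq> \<U>" "|\<V>| <o \<kappa>" for \<V>
      using that by auto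
    \<comment> \<open>The pulled-back complement of \<open>U\<close>. Intersecting with
      \<open>?Y\<close> discards the arguments at which \<open>g\<close> takes values outside the
      square.\<close>
    define c where "c U = {s \<in> ?S. g s \<in> ?Y - U}" for U
    let ?F = "complete_filter_generated \<kappa> ?S (c ` \<U>)"
    have proper: "proper_filter_on ?S ?F"
    proof (rule proper_complete_filter_generated[OF assms(1)])
      fix H assume H: "H \<subseteq> c ` \<U>" "|H| <o \<kappa>"
      \<comment> \<open>One member of the cover is chosen for each generator in \<open>H\<close>;
        taking all members that \<open>c\<close> sends into \<open>H\<close> could give too many, as
        \<open>c\<close> may fail to be injective.\<close>
      let ?\<V> = "inv_into \<U> c ` H"
      have \<V>: "?\<V> \<subseteq> \<U>" using H(1) by (auto intro: inv_into_into)
      have "|?\<V>| <o \<kappa>" using card_of_image H(2) by (rule ordLeq_ordLess_trans)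
      then have "\<Union>?\<V> \<noteq> ?Y" using \<V> no_subcover by blast
      moreover have "\<Union>?\<V> \<subseteq> ?Y" using \<V> \<U>(2) by auto
      ultimately obtain p where p: "p \<in> ?Y" "p \<notin> \<Union>?\<V>" by blast
      from subsetD[OF g p(1)] obtain s where s: "s \<in> ?S" "p = g s" by (rule imageE)
      have "s \<in> A" if "A \<in> H" for A
      proof -
        have "A = c (inv_into \<U> c A)" using f_inv_into_f[OF subsetD[OF H(1) that]] by (rule sym)
        moreover have "p \<notin> inv_into \<U> c A" using p(2) that by blast
        then have "s \<in> c (inv_into \<U> c A)" using p(1) s by (simp add: c_def)
        ultimately show ?thesis by simp
      qed
      then show "?S \<inter> \<Inter>H \<noteq> {}" using s(1) by blast
    qed
    let ?A1 = "\<lambda>B. {s \<in> ?S. fst (g s) \<in> B}" and ?A2 = "\<lambda>B. {s \<in> ?S. snd (g s) \<in> B}"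
    have \<A>: "|?A1 ` \<B> \<union> ?A2 ` \<B>| \<le>o \<Lambda>"
      by (intro card_of_Un_ordLeq_infinite_Field[OF \<Lambda>(1) _ _ \<Lambda>(2)]
            ordLeq_transitive[OF card_of_image \<B>(2)])
    have "|c ` \<U>| \<le>o \<Lambda>"
      by (intro ordLeq_transitive[OF card_of_image] ordLeq_transitive[OF card_of_mono1[OF \<U>(1)]] \<D>_le)
    moreover have "c ` \<U> \<subseteq> Pow ?S" by (auto simp: c_def)
    moreover have "?A1 ` \<B> \<union> ?A2 ` \<B> \<subseteq> Pow ?S" by auto
    ultimately obtain F where F: "?F \<subseteq> F" "proper_filter_on ?S F" "less_complete \<kappa> ?S F"
      and meas: "measures_family ?S F (?A1 ` \<B> \<union> ?A2 ` \<B>)"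
      using assms(4)[unfolded filter_extension_property_def, rule_format,
          of "?A1 ` \<B> \<union> ?A2 ` \<B>" "c ` \<U>" ?F] \<A> proper by blast
    have cF: "c U \<in> F" if "U \<in> \<U>" for U
      using subset_complete_filter_generated[OF assms(1) \<open>c ` \<U> \<subseteq> Pow ?S\<close>] F(1) that by blast
    have inter: "A \<inter> B \<in> F" if "A \<in> F" "B \<in> F" for A B
      using F(2) that unfolding proper_filter_on_def by blast
    have up: "B \<in> F" if "A \<in> F" "A \<subseteq> B" "B \<subseteq> ?S" for A B
      using F(2) that unfolding proper_filter_on_def by blast
    \<comment> \<open>The empty family is not a subcover, so the square is nonempty and the cover
      has a member \<open>U0\<close>. Then \<open>c U0\<close> in \<open>F\<close> shows that
      \<open>g\<close> maps into the square on a set of the filter, which gives the hypothesis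
      \<open>top\<close> for both coordinates.\<close>
    have "\<U> \<noteq> {}"
      using no_subcover[of "{}"] \<U>(2) card_of_empty_ordLess_Cinfinite[OF assms(1)] by auto
    then obtain U0 where "c U0 \<in> F" using cF by blast
    then have top: "?A1 (topspace X) \<in> F" "?A2 (topspace X) \<in> F"
      by (auto elim!: up simp: c_def)
    obtain x where x: "x \<in> topspace X" "\<And>B. B \<in> \<B> \<Longrightarrow> x \<in> B \<Longrightarrow> ?A1 B \<in> F"
      using less_compact_space_limit_point[OF X(2) \<B>(1) F(2,3) top(1)] meas
      unfolding measures_family_def by blast
    obtain y where y: "y \<in> topspace X" "\<And>B. B \<in> \<B> \<Longrightarrow> y \<in> B \<Longrightarrow> ?A2 B \<in> F"
      using less_compact_space_limit_point[OF X(2) \<B>(1) F(2,3) top(2)] meas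
      unfolding measures_family_def by blast
    have "(x, y) \<in> \<Union>\<U>" using x(1) y(1) \<U>(2) by simp
    then obtain D where D: "D \<in> \<U>" "(x, y) \<in> D" by (rule UnionE)
    moreover from subsetD[OF \<U>(1) D(1)] obtain B C where "B \<in> \<B>" "C \<in> \<B>" "D = B \<times> C"
      by auto
    ultimately have BC: "B \<in> \<B>" "C \<in> \<B>" "B \<times> C \<in> \<U>" "x \<in> B" "y \<in> C" by auto
    \<comment> \<open>The first two sets meet in the preimage of the rectangle
      \<open>B \<times> C\<close>, which \<open>c (B \<times> C)\<close> avoids.\<close>
    have "(?A1 B \<inter> ?A2 C) \<inter> c (B \<times> C) \<in> F"
      by (intro inter x(2) y(2) cF BC)
    moreover have "(?A1 B \<inter> ?A2 C) \<inter> c (B \<times> C) = {}"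
      by (auto simp: c_def mem_Times_iff)
    ultimately show False using F(2) unfolding proper_filter_on_def by simp
  qed
qed

end
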